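(* Let $v$ be a vertex of $K_n$ and let $x$ be a dart not in $D_v$. For a uniformly random $m\in\mathcal{M}(K_n)$, for all sufficiently large $n$, $$\Pr[v\notin F_x(m)]\le \frac{4\ln(n-1)}{e\,(n-1)},$$ where $e$ is Euler's number; in particular this probability tends to $0$.
   Context: Let $D=D_1\cup\dots\cup D_n$ be a disjoint union of dart sets with $|D_i|=n-1$, $D_i$ being the darts at vertex $v_i$. $\mathcal{M}(K_n)$ is the set of triples $(D,R,E)$ where $R$ is a permutation of $D$ consisting of $n$ cycles, the $i$-th a full cycle on $D_i$, and $E$ is a fixed-point-free involution of $D$ such that for every $i\ne j$ exactly one $2$-cycle of $E$ contains a dart of $D_i$ and a dart of $D_j$. For a dart $x\in D$, $F_x(m)$ is the cycle of $R\cdot E$ containing $x$ (the face containing $x$). For $v=v_i$, write $D_v=D_i$; we say $v\in F_x(m)$ if some dart of $D_v$ lies in the cycle $F_x(m)$, and $v\notin F_x(m)$ otherwise. *)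

theory Defs
  imports "HOL-Probability.Probability" "HOL-Combinatorics.Orbits"
begin

text \<open>
  The vertices of \<open>K\<^sub>n\<close> are the indices \<open>i < n\<close>, and \<open>D i\<close> is the set of darts at vertex \<open>i\<close>.
\<close>

definition dart_family :: "nat \<Rightarrow> (nat \<Rightarrow> 'a set) \<Rightarrow> bool" where
  "dart_family n D \<longleftrightarrow>
     disjoint_family_on D {..<n} \<and> (\<forall>i<n. finite (D i) \<and> card (D i) = n - 1)"

definition darts :: "nat \<Rightarrow> (nat \<Rightarrow> 'a set) \<Rightarrow> 'a set" where
  "darts n D = (\<Union>i<n. D i)"

definition rotation_system :: "nat \<Rightarrow> (nat \<Rightarrow> 'a set) \<Rightarrow> ('a \<Rightarrow> 'a) \<Rightarrow> bool" where
  "rotation_system n D R \<longleftrightarrow> R permutes darts n D \<and> (\<forall>i<n. cyclic_on R (D i))"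

text \<open>The 2-cycles of the fixed-point-free involution \<open>E\<close> are the sets \<open>{d, E d}\<close>.\<close>

definition edge_scheme :: "nat \<Rightarrow> (nat \<Rightarrow> 'a set) \<Rightarrow> ('a \<Rightarrow> 'a) \<Rightarrow> bool" where
  "edge_scheme n D E \<longleftrightarrow>
     E permutes darts n D \<and>
     (\<forall>d\<in>darts n D. E d \<noteq> d \<and> E (E d) = d) \<and>
     (\<forall>i<n. \<forall>j<n. i \<noteq> j \<longrightarrow>
        (\<exists>!C. C \<in> (\<lambda>d. {d, E d}) ` darts n D \<and> C \<inter> D i \<noteq> {} \<and> C \<inter> D j \<noteq> {}))"

type_synonym 'a comb_map = "'a set \<times> ('a \<Rightarrow> 'a) \<times> ('a \<Rightarrow> 'a)"

definition maps_K :: "nat \<Rightarrow> (nat \<Rightarrow> 'a set) \<Rightarrow> 'a comb_map set" where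
  "maps_K n D = {(darts n D, R, E) | R E. rotation_system n D R \<and> edge_scheme n D E}"

text \<open>
  The product \<open>R \<cdot> E\<close> is read as the composition \<open>R \<circ> E\<close>. The other reading gives the same
  distribution of the dart set of the face at \<open>x\<close>: inverting \<open>R\<close> is a bijection on
  \<open>maps_K n D\<close>, and the inverse of \<open>R \<circ> E\<close> is \<open>E \<circ> inv R\<close>, which has the same cycles as sets.
\<close>

definition face :: "'a comb_map \<Rightarrow> 'a \<Rightarrow> 'a set" where
  "face m x = (case m of (_, R, E) \<Rightarrow> orbit (R \<circ> E) x)"

definition vertex_in_face :: "(nat \<Rightarrow> 'a set) \<Rightarrow> nat \<Rightarrow> 'a comb_map \<Rightarrow> 'a \<Rightarrow> bool" where
  "vertex_in_face D v m x \<longleftrightarrow> D v \<inter> face m x \<noteq> {}"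

definition prob_avoid :: "nat \<Rightarrow> (nat \<Rightarrow> 'a set) \<Rightarrow> nat \<Rightarrow> 'a \<Rightarrow> real" where
  "prob_avoid n D v x =
     measure_pmf.prob (pmf_of_set (maps_K n D)) {m. \<not> vertex_in_face D v m x}"

end

theory Submission imports Defs "HOL-Real_Asymp.Real_Asymp" begin

text \<open>
  The edge scheme \<open>E\<close> is fixed and only the rotations are random. Follow the face from \<open>x\<close>, a dart at
  \<open>w\<close>, revealing one value \<open>R y = z\<close> per step and contracting the revealed arc: replacing \<open>R\<close> by
  \<open>R \<circ> (y z)\<close> and \<open>E\<close> by \<open>(y z) \<circ> E\<close> does not change \<open>R \<circ> E\<close>, and the new rotation is again
  uniformly distributed, with \<open>z\<close> removed from its vertex. At a vertex other than \<open>v\<close> and \<open>w\<close> exactly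
  one value of \<open>R y\<close> leads to \<open>v\<close> and at most one leads to \<open>w\<close>, so the walk reaches \<open>w\<close> before
  \<open>v\<close> with probability at most \<open>1/2\<close>; at \<open>w\<close> a single value closes the face. By induction the face
  closes before meeting \<open>v\<close> with probability at most \<open>1 / (n - 2)\<close>, which is eventually below the
  claimed bound.
\<close>

section \<open>Contracting an arc of a cycle\<close>

abbreviation swap :: "'a \<Rightarrow> 'a \<Rightarrow> 'a \<Rightarrow> 'a" where
  "swap \<equiv> Transposition.transpose"

lemma comp_swap_other: "a \<noteq> y \<Longrightarrow> a \<noteq> z \<Longrightarrow> (f \<circ> swap y z) a = f a"
  by simp

text \<open>An orbit is closed under \<open>f\<close> and lies in every closed set that contains its
  start. Being a single cycle is therefore minimality among nonempty closed sets, a form that is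
  easy to carry through a change of \<open>f\<close> at two points.\<close>

lemma cyclic_on_iff_closed_subsets:
  "cyclic_on f A \<longleftrightarrow> A \<noteq> {} \<and> f ` A \<subseteq> A \<and> (\<forall>B\<subseteq>A. B \<noteq> {} \<and> f ` B \<subseteq> B \<longrightarrow> B = A)"
proof
  assume cyc: "cyclic_on f A"
  have "B = A" if "B \<subseteq> A" "B \<noteq> {}" "f ` B \<subseteq> B" for B
  proof -
    from that obtain b where b: "b \<in> B" by blast
    have "y \<in> B" if "y \<in> orbit f b" for y
      using that by induction (use b \<open>f ` B \<subseteq> B\<close> in auto)
    moreover have "orbit f b = A"
      using cyc b \<open>B \<subseteq> A\<close> by (auto simp: cyclic_on_alldef)
    ultimately show ?thesis using \<open>B \<subseteq> A\<close> by blast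
  qed
  moreover have "A \<noteq> {}" "f ` A \<subseteq> A"
    using cyc by (auto simp: cyclic_on_def intro: orbit.step)
  ultimately show "A \<noteq> {} \<and> f ` A \<subseteq> A \<and> (\<forall>B\<subseteq>A. B \<noteq> {} \<and> f ` B \<subseteq> B \<longrightarrow> B = A)"
    by blast
next
  assume *: "A \<noteq> {} \<and> f ` A \<subseteq> A \<and> (\<forall>B\<subseteq>A. B \<noteq> {} \<and> f ` B \<subseteq> B \<longrightarrow> B = A)"
  then obtain s where s: "s \<in> A" by blast
  have "y \<in> A" if "y \<in> orbit f s" for y
    using that by induction (use s * in auto)
  then have "orbit f s \<subseteq> A" by blast
  moreover have "f ` orbit f s \<subseteq> orbit f s" by (auto intro: orbit.step)
  ultimately have "orbit f s = A" using * orbit_nonempty[of f s] by blast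
  with s show "cyclic_on f A" by (auto simp: cyclic_on_def)
qed

lemma cyclic_on_closedI:
  assumes "A \<noteq> {}" "\<And>a. a \<in> A \<Longrightarrow> f a \<in> A"
    and "\<And>B. B \<subseteq> A \<Longrightarrow> B \<noteq> {} \<Longrightarrow> f ` B \<subseteq> B \<Longrightarrow> B = A"
  shows "cyclic_on f A"
  unfolding cyclic_on_iff_closed_subsets
proof (intro conjI allI impI)
  show "f ` A \<subseteq> A" using assms(2) by (rule image_subsetI)
qed (use assms in simp_all)

lemma cyclic_on_closedD:
  "cyclic_on f A \<Longrightarrow> B \<subseteq> A \<Longrightarrow> B \<noteq> {} \<Longrightarrow> f ` B \<subseteq> B \<Longrightarrow> B = A"
  unfolding cyclic_on_iff_closed_subsets by simp

lemma cyclic_on_cong: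
  assumes "\<And>a. a \<in> A \<Longrightarrow> f a = g a"
  shows "cyclic_on f A \<longleftrightarrow> cyclic_on g A"
proof -
  have "f ` B = g ` B" if "B \<subseteq> A" for B
    using that assms by (intro image_cong) auto
  then show ?thesis by (simp add: cyclic_on_iff_closed_subsets cong: conj_cong imp_cong)
qed

text \<open>As \<open>R y = z\<close>, the new map sends \<open>y\<close> to \<open>R z\<close> and
  fixes \<open>z\<close>: the cycle bypasses \<open>z\<close>. A set closed under the new map
  becomes closed under \<open>R\<close> by adding \<open>z\<close> if it contains \<open>y\<close>,
  and is already closed under \<open>R\<close> otherwise.\<close>

lemma cyclic_on_contract:
  assumes "cyclic_on R A" "inj R" "y \<in> A" "R y = z" "y \<noteq> z"
  shows "cyclic_on (R \<circ> swap y z) (A - {z})"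
proof -
  let ?f = "R \<circ> swap y z"
  have A: "R ` A \<subseteq> A" and min: "\<And>B. B \<subseteq> A \<Longrightarrow> B \<noteq> {} \<Longrightarrow> R ` B \<subseteq> B \<Longrightarrow> B = A"
    using assms(1) unfolding cyclic_on_iff_closed_subsets by auto
  have z: "z \<in> A" using A assms by blast
  \<comment> \<open>A fixed point \<open>z\<close> would make \<open>{z}\<close> closed and hence
    all of \<open>A\<close>, which also contains \<open>y\<close>.\<close>
  have "R z \<noteq> z" using min[of "{z}"] z assms by auto
  have fy: "?f y = R z" by simp
  have f: "?f a = R a" if "a \<noteq> y" "a \<noteq> z" for a using that by simp
  have "?f a \<in> A - {z}" if "a \<in> A - {z}" for a
  proof (cases "a = y")
    case True
    then show ?thesis using fy \<open>R z \<noteq> z\<close> A z by auto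
  next
    case False
    then have "R a \<noteq> z" using \<open>inj R\<close> assms(4) by (metis injD)
    then show ?thesis using f False that A by auto
  qed
  moreover have "B = A - {z}" if B: "B \<subseteq> A - {z}" "B \<noteq> {}" "?f ` B \<subseteq> B" for B
  proof (cases "y \<in> B")
    case True
    then have "R z \<in> B" using fy B(3) by auto
    moreover have "R b \<in> insert z B" if "b \<in> B" for b
    proof (cases "b = y")
      case False
      moreover have "b \<noteq> z" using that B(1) by auto
      ultimately show ?thesis using f[of b] that B(3) by (metis image_subset_iff insertI2)
    qed (use assms(4) in simp)
    ultimately have "R ` insert z B \<subseteq> insert z B" by auto
    then have "insert z B = A" using B z by (intro min) auto
    then show ?thesis using B by auto
  next
    case False
    have "R b \<in> B" if "b \<in> B" for b
    proof -
      have "b \<noteq> y" "b \<noteq> z" using that B(1) False by auto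
      then show ?thesis using f[of b] that B(3) by (metis image_subset_iff)
    qed
    then have "B = A" using B by (intro min) auto
    then show ?thesis using B z by auto
  qed
  moreover have "A - {z} \<noteq> {}" using assms by auto
  ultimately show ?thesis by (intro cyclic_on_closedI)
qed

text \<open>The same transposition inserts the fixed point \<open>z\<close> directly after
  \<open>y\<close>. Removing \<open>z\<close> from a set closed under the new map leaves a set
  closed under \<open>S\<close>.\<close>

lemma cyclic_on_expand:
  assumes "cyclic_on S (A - {z})" "S z = z" "y \<in> A" "z \<in> A" "y \<noteq> z"
  shows "cyclic_on (S \<circ> swap y z) A"
proof -
  let ?f = "S \<circ> swap y z"
  have A: "S ` (A - {z}) \<subseteq> A - {z}"
    and min: "\<And>B. B \<subseteq> A - {z} \<Longrightarrow> B \<noteq> {} \<Longrightarrow> S ` B \<subseteq> B \<Longrightarrow> B = A - {z}"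
    using assms(1) unfolding cyclic_on_iff_closed_subsets by auto
  have fy: "?f y = z" using assms by simp
  have fz: "?f z = S y" by simp
  have f: "?f a = S a" if "a \<noteq> y" "a \<noteq> z" for a using that by simp
  have Sy: "S y \<in> A - {z}" using A assms by auto
  have "?f a \<in> A" if "a \<in> A" for a
  proof (cases "a = y \<or> a = z")
    case True
    then show ?thesis using fy fz Sy assms(4) by auto
  next
    case False
    then have "?f a = S a" "a \<in> A - {z}" using f that by auto
    then show ?thesis using A by auto
  qed
  moreover have "B = A" if B: "B \<subseteq> A" "B \<noteq> {}" "?f ` B \<subseteq> B" for B
  proof -
    have zB: "S y \<in> B" if "z \<in> B" using fz B that by auto
    have yB: "z \<in> B" if "y \<in> B" using fy B that by (metis image_subset_iff)
    have "S b \<in> B - {z}" if "b \<in> B - {z}" for b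
    proof (cases "b = y")
      case True
      then show ?thesis using that zB yB Sy by auto
    next
      case False
      then have "S b \<in> B" using that f[of b] B(3) by (metis DiffE image_subset_iff singletonI)
      moreover have "b \<in> A - {z}" using that B(1) by blast
      ultimately show ?thesis using A by blast
    qed
    \<comment> \<open>If \<open>B\<close> were \<open>{z}\<close>, it would also contain
      \<open>S y\<close>, which differs from \<open>z\<close>.\<close>
    moreover have "B - {z} \<noteq> {}" using B zB Sy by blast
    ultimately have "B - {z} = A - {z}" using B by (intro min) auto
    moreover from this have "z \<in> B" using yB assms by auto
    ultimately show ?thesis using assms by blast
  qed
  moreover have "A \<noteq> {}" using assms by auto
  ultimately show ?thesis by (intro cyclic_on_closedI)
qed

section \<open>Counting rotation systems\<close>

lemma darts_remove:
  assumes "disjoint_family_on A {..<n}" "u < n" "z \<in> A u"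
  shows "darts n (A(u := A u - {z})) = darts n A - {z}"
proof -
  have "z \<notin> A i" if "i < n" "i \<noteq> u" for i
    using that assms by (auto simp: disjoint_family_on_def)
  then show ?thesis using \<open>u < n\<close> by (auto simp: darts_def split: if_splits)
qed

lemma disjoint_family_on_remove:
  assumes "disjoint_family_on A I"
  shows "disjoint_family_on (A(u := A u - B)) I"
  using assms by (auto simp: disjoint_family_on_def)

text \<open>The transposition moves only darts at \<open>u\<close>, so by disjointness the cycles at
  all other vertices stay as they are.\<close>

lemma rotation_system_contract:
  assumes A: "disjoint_family_on A {..<n}" "u < n" "y \<in> A u" "y \<noteq> z"
    and R: "rotation_system n A R" "R y = z"
  shows "rotation_system n (A(u := A u - {z})) (R \<circ> swap y z)"
proof -
  have perm: "R permutes darts n A" and cyc: "\<And>i. i < n \<Longrightarrow> cyclic_on R (A i)"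
    using R by (auto simp: rotation_system_def)
  have z: "z \<in> A u"
    using cyclic_on_inI[OF cyc[OF \<open>u < n\<close>] A(3)] R by simp
  have cyc_u: "cyclic_on (R \<circ> swap y z) (A u - {z})"
    using cyclic_on_contract[OF cyc[OF \<open>u < n\<close>] permutes_inj[OF perm]] A R by auto
  have "R \<circ> swap y z permutes darts n A"
    using perm A z by (intro permutes_compose[OF permutes_swap_id]) (auto simp: darts_def)
  \<comment> \<open>Only \<open>z\<close> has to be checked; as it has become a fixed point, the
    permuted set can shrink to \<open>darts n A - {z}\<close>.\<close>
  moreover have "(R \<circ> swap y z) a = a" if "a \<in> darts n A - (darts n A - {z})" for a
  proof (rule ccontr)
    have "a = z" using that by auto
    moreover assume "(R \<circ> swap y z) a \<noteq> a"
    ultimately show False using R(2) by simp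
  qed
  ultimately have "R \<circ> swap y z permutes darts n A - {z}"
    by (rule permutes_superset)
  moreover have "cyclic_on (R \<circ> swap y z) (A i)" if "i < n" "i \<noteq> u" for i
  proof -
    have "A i \<inter> A u = {}"
      using A \<open>i < n\<close> \<open>i \<noteq> u\<close> by (auto simp: disjoint_family_on_def)
    then have eq: "(R \<circ> swap y z) a = R a" if "a \<in> A i" for a
      using that A(3) z by (intro comp_swap_other) auto
    show ?thesis
      using cyclic_on_cong[of "A i" "R \<circ> swap y z" R, OF eq] cyc[OF \<open>i < n\<close>] by simp
  qed
  ultimately show ?thesis
    using cyc_u darts_remove[OF A(1,2) z] by (auto simp: rotation_system_def)
qed

lemma rotation_system_expand:
  assumes A: "disjoint_family_on A {..<n}" "u < n" "y \<in> A u" "z \<in> A u" "y \<noteq> z"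
    and S: "rotation_system n (A(u := A u - {z})) S"
  shows "rotation_system n A (S \<circ> swap y z)" and "(S \<circ> swap y z) y = z"
proof -
  have perm: "S permutes darts n A - {z}"
    and cyc: "\<And>i. i < n \<Longrightarrow> i \<noteq> u \<Longrightarrow> cyclic_on S (A i)" and cyc_u: "cyclic_on S (A u - {z})"
    using S A darts_remove[OF A(1,2,4)] by (auto simp: rotation_system_def split: if_splits)
  have Sz: "S z = z" using permutes_not_in[OF perm] by simp
  then show "(S \<circ> swap y z) y = z" by simp
  have "S permutes darts n A" using perm by (rule permutes_subset) auto
  then have "S \<circ> swap y z permutes darts n A"
    using A by (intro permutes_compose[OF permutes_swap_id]) (auto simp: darts_def)
  moreover have "cyclic_on (S \<circ> swap y z) (A i)" if "i < n" for i
  proof (cases "i = u")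
    case True
    then show ?thesis using cyclic_on_expand[OF cyc_u Sz] A by auto
  next
    case False
    have "A i \<inter> A u = {}"
      using A \<open>i < n\<close> False by (auto simp: disjoint_family_on_def)
    then have eq: "(S \<circ> swap y z) a = S a" if "a \<in> A i" for a
      using that A(3) A(4) by (intro comp_swap_other) auto
    show ?thesis
      using cyclic_on_cong[of "A i" "S \<circ> swap y z" S, OF eq] cyc[OF \<open>i < n\<close> False] by simp
  qed
  ultimately show "rotation_system n A (S \<circ> swap y z)" by (auto simp: rotation_system_def)
qed

text \<open>A transposition is its own inverse, so contraction and expansion undo each other.
  Conditioning a uniform rotation system on \<open>R y = z\<close> thus yields a uniform one on a
  family with one dart fewer.\<close>

lemma bij_betw_rotation_system_contract:
  assumes "disjoint_family_on A {..<n}" "u < n" "y \<in> A u" "z \<in> A u" "y \<noteq> z"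
  shows "bij_betw (\<lambda>R. R \<circ> swap y z) {R. rotation_system n A R \<and> R y = z}
    {S. rotation_system n (A(u := A u - {z})) S}"
proof (rule bij_betw_byWitness[where f' = "\<lambda>S. S \<circ> swap y z"])
  show "(\<lambda>R. R \<circ> swap y z) ` {R. rotation_system n A R \<and> R y = z}
      \<subseteq> {S. rotation_system n (A(u := A u - {z})) S}"
    using rotation_system_contract[OF assms(1-3,5)] by blast
  show "(\<lambda>S. S \<circ> swap y z) ` {S. rotation_system n (A(u := A u - {z})) S}
      \<subseteq> {R. rotation_system n A R \<and> R y = z}"
    using rotation_system_expand[OF assms] by blast
qed (simp_all add: comp_assoc)

lemma finite_rotation_systems:
  assumes "\<And>i. i < n \<Longrightarrow> finite (A i)"
  shows "finite {R. rotation_system n A R}"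
proof (rule finite_subset)
  show "{R. rotation_system n A R} \<subseteq> {R. R permutes darts n A}"
    by (auto simp: rotation_system_def)
  show "finite {R. R permutes darts n A}"
    using assms by (intro finite_permutations) (auto simp: darts_def)
qed

text \<open>With two or more darts at \<open>u\<close>, the set \<open>{y}\<close> is not the whole
  cycle, so \<open>y\<close> cannot be a fixed point.\<close>

lemma rotation_systems_partition:
  assumes "disjoint_family_on A {..<n}" "u < n" "y \<in> A u" "card (A u) \<ge> 2"
  shows "{R. rotation_system n A R} = (\<Union>z\<in>A u - {y}. {R. rotation_system n A R \<and> R y = z})"
proof -
  have "R y \<in> A u - {y}" if "rotation_system n A R" for R
  proof -
    have cyc: "cyclic_on R (A u)" using that assms by (auto simp: rotation_system_def)
    have "R y \<in> A u" using cyc assms(3) by (rule cyclic_on_inI)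
    moreover have "R y \<noteq> y"
    proof
      assume "R y = y"
      then have "{y} = A u" using assms by (intro cyclic_on_closedD[OF cyc]) auto
      then show False using assms(4) by (metis card.empty card.insert empty_iff finite.emptyI
            not_less_eq_eq numeral_2_eq_2 One_nat_def le_refl)
    qed
    ultimately show ?thesis by simp
  qed
  then show ?thesis by blast
qed

text \<open>Induction on the total number of darts. At a vertex with \<open>k \<ge> 2\<close> darts,
  the value at \<open>y\<close> has \<open>k - 1\<close> choices, and each contraction leaves a
  factor \<open>(k - 2)!\<close> there. If every vertex has a single dart, only the identity is
  left.\<close>

lemma card_rotation_systems:
  assumes "disjoint_family_on A {..<n}" "\<And>i. i < n \<Longrightarrow> finite (A i) \<and> A i \<noteq> {}"
  shows "card {R. rotation_system n A R} = (\<Prod>i<n. fact (card (A i) - 1))"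
  using assms
proof (induction "\<Sum>i<n. card (A i)" arbitrary: A rule: less_induct)
  case (less A)
  show ?case
  proof (cases "\<exists>u<n. card (A u) \<ge> 2")
    case True
    then obtain u where u: "u < n" "card (A u) \<ge> 2" by blast
    have fin: "finite (A u)" and "A u \<noteq> {}" using less.prems u by auto
    then obtain y where y: "y \<in> A u" by blast
    have rest: "card {R. rotation_system n A R \<and> R y = z} = fact (card (A u) - 2) *
        (\<Prod>i\<in>{..<n} - {u}. fact (card (A i) - 1))" if z: "z \<in> A u - {y}" for z
    proof -
      let ?A = "A(u := A u - {z})"
      have "card {R. rotation_system n A R \<and> R y = z} = card {R. rotation_system n ?A R}"
        using bij_betw_same_card[OF bij_betw_rotation_system_contract[of A n u y z]]
          less.prems u y z by auto
      also have "\<dots> = (\<Prod>i<n. fact (card (?A i) - 1))"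
      proof (rule less.hyps)
        have "card (A u - {z}) < card (A u)" using fin z by (meson DiffD1 card_Diff1_less)
        then show "(\<Sum>i<n. card (?A i)) < (\<Sum>i<n. card (A i))"
          using u by (intro sum_strict_mono_ex1) auto
        show "disjoint_family_on ?A {..<n}"
          using less.prems by (intro disjoint_family_on_remove)
        show "finite (?A i) \<and> ?A i \<noteq> {}" if "i < n" for i
          using less.prems(2)[OF that] y z by auto
      qed
      also have "\<dots> = fact (card (A u - {z}) - 1) * (\<Prod>i\<in>{..<n} - {u}. fact (card (?A i) - 1))"
        using u by (subst prod.remove[of _ u]) auto
      also have "(\<Prod>i\<in>{..<n} - {u}. fact (card (?A i) - 1) :: nat) =
          (\<Prod>i\<in>{..<n} - {u}. fact (card (A i) - 1))"
        by (intro prod.cong) auto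
      also have "card (A u - {z}) - 1 = card (A u) - 2" using z fin by simp
      finally show ?thesis .
    qed
    have "card {R. rotation_system n A R} =
        card (\<Union>z\<in>A u - {y}. {R. rotation_system n A R \<and> R y = z})"
      using rotation_systems_partition[of A n u y] less.prems u y by simp
    also have "\<dots> = (\<Sum>z\<in>A u - {y}. card {R. rotation_system n A R \<and> R y = z})"
      using fin finite_rotation_systems[of n A] less.prems
      by (intro card_UN_disjoint) (auto intro: rev_finite_subset)
    also have "\<dots> = (card (A u) - 1) * (fact (card (A u) - 2) *
        (\<Prod>i\<in>{..<n} - {u}. fact (card (A i) - 1)))"
      using rest fin y by simp
    also have "\<dots> = (card (A u) - 1) * fact (card (A u) - 2) *
        (\<Prod>i\<in>{..<n} - {u}. fact (card (A i) - 1))"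
      by simp
    also have "(card (A u) - 1) * fact (card (A u) - 2) = (fact (card (A u) - 1) :: nat)"
      using fact_reduce[of "card (A u) - 1", where 'a = nat] u by (simp add: numeral_2_eq_2)
    also have "\<dots> * (\<Prod>i\<in>{..<n} - {u}. fact (card (A i) - 1)) =
        (\<Prod>i<n. fact (card (A i) - 1))"
      using u by (subst (2) prod.remove[of _ u]) auto
    finally show ?thesis .
  next
    case False
    then have one: "card (A i) = 1" if "i < n" for i
      using less.prems(2)[OF that] that by (metis One_nat_def Suc_1 card_gt_0_iff le_SucE
          less_eq_Suc_le not_less_eq_eq)
    have "rotation_system n A R \<longleftrightarrow> R = id" for R
    proof
      assume R: "rotation_system n A R"
      have "R a = a" if "a \<in> A i" "i < n" for a i
      proof -
        have "R a \<in> A i" using R that by (auto simp: rotation_system_def intro: cyclic_on_inI)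
        then show ?thesis using one[OF \<open>i < n\<close>] that by (metis card_1_singletonE singletonD)
      qed
      then show "R = id"
        using R by (fastforce simp: rotation_system_def permutes_def darts_def)
    next
      assume "R = id"
      moreover have "cyclic_on id (A i)" if i: "i < n" for i
      proof (rule cyclic_on_closedI)
        obtain a where "A i = {a}" using one[OF i] by (auto simp: card_1_singleton_iff)
        then show "A i \<noteq> {}" "\<And>B. B \<subseteq> A i \<Longrightarrow> B \<noteq> {} \<Longrightarrow> B = A i" by auto
      qed simp
      ultimately show "rotation_system n A R" by (auto simp: rotation_system_def permutes_id)
    qed
    then have "{R. rotation_system n A R} = {id}" by blast
    then show ?thesis using one by simp
  qed
qed

text \<open>The contracted family has the same sizes for every choice of \<open>z\<close>, so
  \<open>R y\<close> is uniform on \<open>A u - {y}\<close>. This is the law of each step of the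
  walk.\<close>

lemma card_rotation_systems_arc:
  assumes "disjoint_family_on A {..<n}" "\<And>i. i < n \<Longrightarrow> finite (A i)"
    and "\<And>i. i < n \<Longrightarrow> A i \<noteq> {}" and u: "u < n" "y \<in> A u" "z \<in> A u" "y \<noteq> z"
  shows "card {R. rotation_system n A R} =
    (card (A u) - 1) * card {R. rotation_system n A R \<and> R y = z}"
proof -
  let ?A = "A(u := A u - {z})"
  have fin: "finite (A u)" using assms by blast
  have "card {y, z} \<le> card (A u)" using u fin by (intro card_mono) auto
  then have two: "card (A u) \<ge> 2" using u by simp
  have "card {R. rotation_system n A R \<and> R y = z} = card {R. rotation_system n ?A R}"
    using bij_betw_same_card[OF bij_betw_rotation_system_contract[of A n u y z]] assms by auto
  also have "\<dots> = (\<Prod>i<n. fact (card (?A i) - 1))"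
    using assms by (intro card_rotation_systems disjoint_family_on_remove) auto
  also have "\<dots> = fact (card (A u) - 2) * (\<Prod>i\<in>{..<n} - {u}. fact (card (?A i) - 1))"
    using u fin by (subst prod.remove[of _ u]) (auto simp: numeral_2_eq_2)
  also have "(\<Prod>i\<in>{..<n} - {u}. fact (card (?A i) - 1) :: nat) =
      (\<Prod>i\<in>{..<n} - {u}. fact (card (A i) - 1))"
    by (intro prod.cong) auto
  finally have "(card (A u) - 1) * card {R. rotation_system n A R \<and> R y = z} =
      (card (A u) - 1) * fact (card (A u) - 2) * (\<Prod>i\<in>{..<n} - {u}. fact (card (A i) - 1))"
    by (simp only: mult.assoc)
  also have "(card (A u) - 1) * fact (card (A u) - 2) = (fact (card (A u) - 1) :: nat)"
    using fact_reduce[of "card (A u) - 1", where 'a = nat] two by (simp add: numeral_2_eq_2)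
  also have "\<dots> * (\<Prod>i\<in>{..<n} - {u}. fact (card (A i) - 1)) = (\<Prod>i<n. fact (card (A i) - 1))"
    using u by (subst (2) prod.remove[of _ u]) auto
  also have "\<dots> = card {R. rotation_system n A R}"
    using assms by (intro card_rotation_systems[symmetric]) auto
  finally show ?thesis ..
qed

section \<open>Walks that close up before reaching a given vertex\<close>

text \<open>Only the current point varies, so inverting a derivation exposes the first step. The
  final point \<open>t\<close> is not tested against \<open>Q\<close>, and earlier passages through
  \<open>t\<close> are permitted.\<close>

inductive returns_avoiding :: "('a \<Rightarrow> 'a) \<Rightarrow> 'a set \<Rightarrow> 'a \<Rightarrow> 'a \<Rightarrow> bool" for f Q t where
  hit: "x \<notin> Q \<Longrightarrow> f x = t \<Longrightarrow> returns_avoiding f Q t x"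
| step: "x \<notin> Q \<Longrightarrow> returns_avoiding f Q t (f x) \<Longrightarrow> returns_avoiding f Q t x"

text \<open>Orbits are built by adding a step at the end, \<open>returns_avoiding\<close> by adding
  one at the start. This rule supplies the other direction; the old target becomes an intermediate
  point and must therefore lie outside \<open>Q\<close>.\<close>

lemma returns_avoiding_snoc:
  assumes "returns_avoiding f Q t x" "t \<notin> Q"
  shows "returns_avoiding f Q (f t) x"
  using assms by induction (auto intro: returns_avoiding.intros)

lemma orbit_imp_returns_avoiding:
  assumes "t \<in> orbit f x" "orbit f x \<inter> Q = {}" "x \<notin> Q"
  shows "returns_avoiding f Q t x"
  using assms
proof induction
  case (step y)
  then show ?case by (intro returns_avoiding_snoc) auto
qed (auto intro: returns_avoiding.intros)

text \<open>The edge scheme enters through the labels \<open>nb\<close>, which stay fixed while the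
  edge map is rewritten. That \<open>K_n\<close> is simple appears as \<open>inj_nb\<close> (no
  parallel edges) and \<open>nb_neq\<close> (no loops). If \<open>x0\<close> led to
  \<open>v\<close>, the face would meet \<open>v\<close> at once; that case is treated
  separately.\<close>

locale face_walk =
  fixes n :: nat and D :: "nat \<Rightarrow> 'a set" and nb :: "'a \<Rightarrow> nat" and v w :: nat and x0 :: 'a
  assumes disj: "disjoint_family_on D {..<n}"
    and fin: "i < n \<Longrightarrow> finite (D i)"
    and v: "v < n" and w: "w < n" and vw: "v \<noteq> w"
    and inj_nb: "i < n \<Longrightarrow> inj_on nb (D i)"
    and nb_less: "i < n \<Longrightarrow> z \<in> D i \<Longrightarrow> nb z < n"
    and nb_neq: "i < n \<Longrightarrow> z \<in> D i \<Longrightarrow> nb z \<noteq> i"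
    and x0: "x0 \<in> D w" "nb x0 \<noteq> v"
begin

text \<open>
  Here \<open>nb z\<close> is the vertex at the other end of the edge of \<open>z\<close>; it is not affected by contractions.
  The walk started at \<open>x0\<close> has reached \<open>x\<close>; \<open>A i\<close> are the darts at \<open>i\<close> not yet taken as values.
\<close>

definition walk_state :: "(nat \<Rightarrow> 'a set) \<Rightarrow> ('a \<Rightarrow> 'a) \<Rightarrow> 'a \<Rightarrow> bool" where
  "walk_state A E x \<longleftrightarrow>
     (\<forall>i<n. A i \<subseteq> D i) \<and> A v \<noteq> {} \<and> inj E \<and> x0 \<in> A w \<and>
     x \<in> darts n D - D v \<and> nb x \<noteq> v \<and> (x \<in> darts n A \<longrightarrow> x = x0) \<and>
     (\<forall>z \<in> insert x (darts n A - {x0}). E z \<in> A (nb z)) \<and>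
     (\<forall>i<n. i \<noteq> v \<longrightarrow> (\<exists>s\<in>A i. nb s = v)) \<and>
     (\<forall>z \<in> insert x (darts n A) - D v. nb (E z) \<noteq> v)"

lemma darts_unique: "i < n \<Longrightarrow> j < n \<Longrightarrow> z \<in> D i \<Longrightarrow> z \<in> D j \<Longrightarrow> i = j"
  using disj by (auto simp: disjoint_family_on_def)

lemma walk_stateD:
  assumes "walk_state A E x"
  shows "i < n \<Longrightarrow> A i \<subseteq> D i" "A v \<noteq> {}" "inj E" "x0 \<in> A w"
    and "x \<in> darts n D" "x \<notin> D v" "nb x \<noteq> v" "x \<in> darts n A \<Longrightarrow> x = x0"
    and "z \<in> insert x (darts n A - {x0}) \<Longrightarrow> E z \<in> A (nb z)"
    and "i < n \<Longrightarrow> i \<noteq> v \<Longrightarrow> \<exists>s\<in>A i. nb s = v"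
    and "z \<in> insert x (darts n A) \<Longrightarrow> z \<notin> D v \<Longrightarrow> nb (E z) \<noteq> v"
  using assms[unfolded walk_state_def] by (elim conjE; blast)+

lemma walk_state_disjoint:
  assumes "walk_state A E x"
  shows "disjoint_family_on A {..<n}"
  unfolding disjoint_family_on_def
proof (intro ballI impI)
  fix i j assume "i \<in> {..<n}" "j \<in> {..<n}" "i \<noteq> j"
  then have "D i \<inter> D j = {}" "A i \<subseteq> D i" "A j \<subseteq> D j"
    using disj walk_stateD(1)[OF assms] by (auto simp: disjoint_family_on_def)
  then show "A i \<inter> A j = {}" by blast
qed

text \<open>Contracting the arc from \<open>y = E x\<close> to \<open>z\<close> redirects an edge
  ending in \<open>z\<close> to \<open>y\<close>, a dart at the same vertex, so \<open>nb\<close>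
  still describes it. The edge of \<open>x\<close> now ends in the deleted \<open>z\<close>; this is
  why \<open>x0\<close>, the only dart left among the \<open>A i\<close> from which the walk may
  have departed, is exempt. Spokes to \<open>v\<close> survive because \<open>z\<close> is not one
  of them.\<close>

lemma walk_state_step:
  assumes st: "walk_state A E x"
    and z: "z \<in> A (nb x) - {E x}" "z \<noteq> x0" "nb z \<noteq> v"
  shows "walk_state (A(nb x := A (nb x) - {z})) (swap (E x) z \<circ> E) z"
proof -
  define u where "u = nb x"
  define y where "y = E x"
  let ?A = "A(u := A u - {z})"
  note sub = walk_stateD(1)[OF st] and x0A = walk_stateD(4)[OF st]
    and x = walk_stateD(5-8)[OF st] and E = walk_stateD(9)[OF st]
    and sp = walk_stateD(10)[OF st] and av = walk_stateD(11)[OF st]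
  have "inj E" using st by (rule walk_stateD)
  have u: "u < n" "u \<noteq> v" using x nb_less unfolding u_def darts_def by auto
  have y: "y \<in> A u" "nb y \<noteq> v" using E[of x] av[of x] x by (auto simp: u_def y_def)
  have zu: "z \<in> A u" "z \<noteq> y" using z by (auto simp: u_def y_def)
  have zD: "z \<in> D u" using sub u zu by auto
  have zv: "z \<notin> D v" using darts_unique[OF u(1) v zD] u by auto
  note disjA = walk_state_disjoint[OF st]
  have dA: "darts n ?A = darts n A - {z}" using darts_remove[OF disjA u(1) zu(1)] .
  have zA: "z \<in> darts n A" using u zu by (auto simp: darts_def)
  have E': "(swap y z \<circ> E) z' \<in> ?A (nb z')" if "z' \<in> insert z (darts n ?A - {x0})" for z'
  proof -
    have z': "z' \<in> darts n A - {x0}" using that dA zA z by auto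
    then have "z' \<noteq> x" using x by auto
    \<comment> \<open>By injectivity only \<open>x\<close> has its edge ending in \<open>y\<close>,
      so the transposition affects \<open>z'\<close> only if \<open>E z' = z\<close>.\<close>
    then have ney: "E z' \<noteq> y" using \<open>inj E\<close> by (auto simp: y_def dest: injD)
    have in': "E z' \<in> A (nb z')" using E z' by auto
    show ?thesis
    proof (cases "E z' = z")
      case True
      obtain i where "i < n" "z' \<in> D i" using z' sub by (auto simp: darts_def)
      then have less: "nb z' < n" using nb_less by blast
      then have "nb z' = u" using darts_unique[OF less u(1)] sub[OF less] in' True zD by auto
      then show ?thesis using True y zu by simp
    next
      case False
      then show ?thesis using ney in' by auto
    qed
  qed
  have av': "nb ((swap y z \<circ> E) z') \<noteq> v" if "z' \<in> insert z (darts n ?A) - D v" for z'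
  proof -
    have "nb (E z') \<noteq> v" using that dA zA by (intro av) auto
    \<comment> \<open>Neither \<open>y\<close> nor \<open>z\<close> leads to \<open>v\<close>, so
      exchanging them cannot create a forbidden endpoint.\<close>
    then show ?thesis using y z by (cases "E z' = y"; cases "E z' = z") auto
  qed
  have sp': "\<exists>s\<in>?A i. nb s = v" if "i < n" "i \<noteq> v" for i
    using sp[OF that] z by auto
  have "walk_state ?A (swap y z \<circ> E) z"
    unfolding walk_state_def
  proof (intro conjI)
    show "\<forall>i<n. ?A i \<subseteq> D i" using sub by auto
    show "?A v \<noteq> {}" using walk_stateD(2)[OF st] u by auto
    show "inj (swap y z \<circ> E)" using \<open>inj E\<close> by (intro inj_compose) auto
    show "x0 \<in> ?A w" using x0A z by auto
    show "z \<in> darts n D - D v" using zD zv u by (auto simp: darts_def)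
    show "nb z \<noteq> v" by fact
    show "z \<in> darts n ?A \<longrightarrow> z = x0" using dA by auto
  next
    show "\<forall>z'\<in>insert z (darts n ?A - {x0}). (swap y z \<circ> E) z' \<in> ?A (nb z')" using E' by blast
    show "\<forall>z'\<in>insert z (darts n ?A) - D v. nb ((swap y z \<circ> E) z') \<noteq> v" using av' by blast
    show "\<forall>i<n. i \<noteq> v \<longrightarrow> (\<exists>s\<in>?A i. nb s = v)" using sp' by blast
  qed
  then show ?thesis by (simp add: u_def y_def)
qed

text \<open>Induction on the remaining darts, with the value \<open>z\<close> of \<open>R\<close> at
  \<open>E x\<close> revealed. Away from \<open>w\<close>, a value leading to \<open>v\<close>
  contributes nothing and pays for the single possible value leading to \<open>w\<close>, where the
  bound doubles. At \<open>w\<close>, the closing value contributes at most one fibre, and all other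
  values together at most one more.\<close>

lemma card_returns_avoiding_le:
  assumes "walk_state A E x"
  shows "real (card {R. rotation_system n A R \<and> returns_avoiding (R \<circ> E) {z. nb z = v} x0 x})
    \<le> (if nb x = w then 2 else 1) / (real (card (A w)) - 1) * card {R. rotation_system n A R}"
  using assms
proof (induction "card (darts n A)" arbitrary: A E x rule: less_induct)
  case (less A E x)
  define u where "u = nb x"
  define y where "y = E x"
  define Q where "Q = {z. nb z = v}"
  note st = less.prems
  note sub = walk_stateD(1)[OF st] and x0A = walk_stateD(4)[OF st]
    and x = walk_stateD(5-7)[OF st] and sp = walk_stateD(10)[OF st]
  have Ex: "E x \<in> A (nb x)" "nb (E x) \<noteq> v"
    using walk_stateD(9,11)[OF st, of x] x by auto
  note disjA = walk_state_disjoint[OF st]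
  have finA: "finite (A i)" if "i < n" for i using sub fin that by (meson finite_subset)
  have neA: "A i \<noteq> {}" if "i < n" for i using sp[OF that] walk_stateD(2)[OF st] by (cases "i = v") auto
  have findarts: "finite (darts n A)" using finA by (auto simp: darts_def)
  have finR: "finite {R. rotation_system n A R}" using finA by (rule finite_rotation_systems)
  have u: "u < n" "u \<noteq> v" using x nb_less unfolding u_def darts_def by auto
  have y: "y \<in> A u" "nb y \<noteq> v" using Ex by (auto simp: u_def y_def)
  obtain s where s: "s \<in> A u" "nb s = v" using sp[OF u] by blast
  have sy: "s \<noteq> y" using s y by auto
  obtain s' where s': "s' \<in> A w" "nb s' = v" using sp[OF w] vw by blast
  \<comment> \<open>The start and the spoke to \<open>v\<close> are two different darts at
    \<open>w\<close>, which keeps \<open>card (A w) - 1\<close> positive.\<close>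
  have "card {x0, s'} \<le> card (A w)" using s' x0A finA[OF w] by (intro card_mono) auto
  moreover have "x0 \<noteq> s'" using s' x0 by auto
  ultimately have c: "card (A w) \<ge> 2" by simp
  have "card {y, s} \<le> card (A u)" using s y finA[OF u(1)] by (intro card_mono) auto
  then have a: "card (A u) \<ge> 2" using sy by auto
  define B where "B = A u - {y}"
  have finB: "finite B" and cardB: "card B = card (A u) - 1" and sB: "s \<in> B"
    using finA[OF u(1)] y s sy by (auto simp: B_def)
  \<comment> \<open>\<open>T\<close> is the common size of the fibres \<open>R y = z\<close> for
    \<open>z\<close> in \<open>B\<close>; the fibre over \<open>s\<close> serves as
    representative.\<close>
  define T where "T = real (card {R. rotation_system n A R \<and> R y = s})"
  define G where "G z = {R. rotation_system n A R \<and> R y = z \<and> returns_avoiding (R \<circ> E) Q x0 x}" for z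
  have total: "real (card {R. rotation_system n A R}) = real (card B) * T"
    using card_rotation_systems_arc[OF disjA finA neA u(1) y(1) s(1)] sy cardB
    by (simp add: T_def)
  have arc: "real (card {R. rotation_system n A R \<and> R y = z}) = T" if "z \<in> B" for z
  proof -
    have "card (A u) - 1 > 0" using a by simp
    then show ?thesis
      using card_rotation_systems_arc[OF disjA finA neA u(1) y(1) s(1)]
        card_rotation_systems_arc[OF disjA finA neA u(1) y(1), of z] that sy
      by (auto simp: T_def B_def)
  qed
  have G_unfold: "z \<notin> Q \<and> returns_avoiding (R \<circ> E) Q x0 z" if "R \<in> G z" "z \<noteq> x0" for R z
  proof -
    have "returns_avoiding (R \<circ> E) Q x0 x" and Rx: "(R \<circ> E) x = z"
      using that by (auto simp: G_def y_def)
    then have "returns_avoiding (R \<circ> E) Q x0 z"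
      using that(2) by (cases rule: returns_avoiding.cases) auto
    then show ?thesis by (auto elim: returns_avoiding.cases)
  qed
  \<comment> \<open>Such a \<open>z\<close> lies in \<open>Q\<close>, and it is not
    \<open>x0\<close>, so the walk is stopped there.\<close>
  have G_v: "card (G z) = 0" if "nb z = v" for z
    using G_unfold[of _ z] that x0 by (auto simp: Q_def card_eq_0_iff)
  have G_le: "real (card (G z)) \<le> T" if "z \<in> B" for z
  proof -
    have "card (G z) \<le> card {R. rotation_system n A R \<and> R y = z}"
      using finR by (intro card_mono) (auto simp: G_def intro: rev_finite_subset)
    then show ?thesis using arc[OF that] by simp
  qed
  have G_step: "real (card (G z)) \<le>
      (if nb z = w then 2 else 1) / (real (card ((A(u := A u - {z})) w)) - 1) * T"
    if z: "z \<in> B" "z \<noteq> x0" "nb z \<noteq> v" for z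
  proof -
    let ?A = "A(u := A u - {z})" and ?E = "swap y z \<circ> E"
    have zu: "z \<in> A u" "y \<noteq> z" using z by (auto simp: B_def)
    note bij = bij_betw_rotation_system_contract[OF disjA u(1) y(1) zu]
    have "card (G z) \<le> card {S. rotation_system n ?A S \<and> returns_avoiding (S \<circ> ?E) Q x0 z}"
    proof (rule card_inj_on_le)
      show "inj_on (\<lambda>R. R \<circ> swap y z) (G z)"
        using bij_betw_imp_inj_on[OF bij] by (rule inj_on_subset) (auto simp: G_def)
      have "returns_avoiding ((R \<circ> swap y z) \<circ> ?E) Q x0 z" if "R \<in> G z" for R
      proof -
        \<comment> \<open>The two transpositions cancel, so the contracted data follow the same
          walk.\<close>
        have "(R \<circ> swap y z) \<circ> ?E = R \<circ> E" by (simp add: fun_eq_iff)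
        then show ?thesis using G_unfold[OF that z(2)] by simp
      qed
      moreover have "rotation_system n ?A (R \<circ> swap y z)" if "R \<in> G z" for R
        using that rotation_system_contract[OF disjA u(1) y(1) zu(2)] by (auto simp: G_def)
      ultimately show "(\<lambda>R. R \<circ> swap y z) ` G z \<subseteq>
          {S. rotation_system n ?A S \<and> returns_avoiding (S \<circ> ?E) Q x0 z}"
        by blast
      show "finite {S. rotation_system n ?A S \<and> returns_avoiding (S \<circ> ?E) Q x0 z}"
        using finite_rotation_systems[of n ?A] finA
        by (auto elim!: rev_finite_subset)
    qed
    then have "real (card (G z)) \<le>
        real (card {S. rotation_system n ?A S \<and> returns_avoiding (S \<circ> ?E) Q x0 z})"
      by simp
    also have "\<dots> \<le> (if nb z = w then 2 else 1) / (real (card (?A w)) - 1) *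
        card {S. rotation_system n ?A S}"
      unfolding Q_def
    proof (rule less.hyps)
      have "darts n ?A \<subset> darts n A"
        using darts_remove[OF disjA u(1) zu(1)] u zu by (auto simp: darts_def)
      then show "card (darts n ?A) < card (darts n A)" using findarts by (rule psubset_card_mono[rotated])
      show "walk_state ?A ?E z"
        unfolding u_def y_def
        using less.prems z by (intro walk_state_step) (auto simp: B_def u_def y_def)
    qed
    also have "real (card {S. rotation_system n ?A S}) = T"
      using bij_betw_same_card[OF bij] arc[OF z(1)] by simp
    finally show ?thesis .
  qed
  have "{R. rotation_system n A R \<and> returns_avoiding (R \<circ> E) Q x0 x} \<subseteq> (\<Union>z\<in>B. G z)"
    using rotation_systems_partition[OF disjA u(1) y(1) a] by (auto simp: G_def B_def)
  then have "card {R. rotation_system n A R \<and> returns_avoiding (R \<circ> E) Q x0 x} \<le>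
      card (\<Union>z\<in>B. G z)"
    using finB finR by (intro card_mono) (auto simp: G_def intro: rev_finite_subset)
  also have "\<dots> \<le> (\<Sum>z\<in>B. card (G z))" using finB by (rule card_UN_le)
  finally have "real (card {R. rotation_system n A R \<and> returns_avoiding (R \<circ> E) Q x0 x}) \<le>
      (\<Sum>z\<in>B. real (card (G z)))"
    unfolding of_nat_sum[symmetric] by (rule of_nat_mono)
  also have "\<dots> \<le> (if u = w then 2 else 1) / (real (card (A w)) - 1) * (real (card B) * T)"
  proof (cases "u = w")
    case False
    \<comment> \<open>The weights are 0 for values leading to \<open>v\<close>, 2 for those leading
      to \<open>w\<close> and 1 for the others. Here \<open>A w\<close> keeps its size, as the
      deleted dart is at \<open>u \<noteq> w\<close>.\<close>
    have "real (card (G z)) \<le>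
        (1 - of_bool (nb z = v) + of_bool (nb z = w)) * (T / (real (card (A w)) - 1))"
      if "z \<in> B" for z
    proof (cases "nb z = v")
      case True
      then show ?thesis using G_v vw by simp
    next
      case nv: False
      have "z \<noteq> x0"
        using darts_unique[OF u(1) w] False that sub[OF u(1)] x0 by (auto simp: B_def)
      then show ?thesis using G_step[OF that _ nv] False nv by auto
    qed
    then have "(\<Sum>z\<in>B. real (card (G z))) \<le>
        (\<Sum>z\<in>B. (1 - of_bool (nb z = v) + of_bool (nb z = w)) * (T / (real (card (A w)) - 1)))"
      by (rule sum_mono)
    also have "\<dots> = (real (card B) - card (B \<inter> {z. nb z = v}) + card (B \<inter> {z. nb z = w})) *
        (T / (real (card (A w)) - 1))"
      unfolding sum_distrib_right[symmetric]
      using finB by (simp add: sum.distrib sum_subtractf sum_of_bool_eq)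
    also have "\<dots> \<le> real (card B) * (T / (real (card (A w)) - 1))"
    proof (rule mult_right_mono)
      have "B \<subseteq> D u" using sub u by (auto simp: B_def)
      \<comment> \<open>Injectivity allows at most one dart of \<open>B\<close> leading to
        \<open>w\<close>, while \<open>s\<close> guarantees one leading to \<open>v\<close>: the
        gain is covered by the loss.\<close>
      then have "inj_on nb B" using inj_nb[OF u(1)] inj_on_subset by blast
      then have "card (B \<inter> {z. nb z = w}) \<le> card {w}"
        by (intro card_inj_on_le[of nb]) (auto intro: inj_on_subset)
      moreover have "card {s} \<le> card (B \<inter> {z. nb z = v})"
        using sB s finB by (intro card_mono) auto
      ultimately show "real (card B) - card (B \<inter> {z. nb z = v}) + card (B \<inter> {z. nb z = w}) \<le> card B"
        by simp
      show "0 \<le> T / (real (card (A w)) - 1)" using c by (simp add: T_def)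
    qed
    finally show ?thesis using False by simp
  next
    case True
    have T0: "T \<ge> 0" by (simp add: T_def)
    have cB: "real (card B) = real (card (A w)) - 1" using cardB c True by simp
    \<comment> \<open>Any other value deletes a dart at \<open>w\<close>, which turns the
      denominator into \<open>card (A w) - 2\<close>; since there are no loops it leads away from
      \<open>w\<close>, so the induction hypothesis applies with factor 1.\<close>
    have "real (card (G z)) \<le> (of_bool (z = x0) + of_bool (z \<noteq> s) / (real (card (A w)) - 2)) * T"
      if "z \<in> B" for z
    proof (cases "nb z = v \<or> z = x0")
      case True
      define k where "k = of_bool (z \<noteq> s) / (real (card (A w)) - 2)"
      have "k \<ge> 0" using c by (simp add: k_def)
      then have kT: "0 \<le> k * T" using T0 by (rule mult_nonneg_nonneg)
      have "real (card (G z)) \<le> (of_bool (z = x0) + k) * T"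
      proof (cases "z = x0")
        case True
        then show ?thesis using G_le[OF that] kT by (simp add: distrib_right)
      next
        case False
        then show ?thesis using True G_v kT by simp
      qed
      then show ?thesis by (simp only: k_def)
    next
      case z: False
      have "nb z \<noteq> w"
        using nb_neq[OF u(1)] that sub[OF u(1)] True by (auto simp: B_def)
      moreover have "z \<in> A w" using that True by (simp add: B_def)
      ultimately have "real (card (G z)) \<le> 1 / (real (card (A w)) - 2) * T"
        using G_step[OF that] z True finA[OF w] c by auto
      then show ?thesis using z s(2) by auto
    qed
    then have "(\<Sum>z\<in>B. real (card (G z))) \<le>
        (\<Sum>z\<in>B. (of_bool (z = x0) + of_bool (z \<noteq> s) / (real (card (A w)) - 2)) * T)"
      by (rule sum_mono)
    also have "\<dots> = (card (B \<inter> {z. z = x0}) + card (B \<inter> {z. z \<noteq> s}) / (real (card (A w)) - 2)) * T"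
      unfolding sum_distrib_right[symmetric]
      using finB by (simp add: sum.distrib sum_of_bool_eq sum_divide_distrib[symmetric])
    also have "\<dots> \<le> 2 * T"
    proof (rule mult_right_mono)
      have "card (B \<inter> {z. z = x0}) \<le> card {x0}" by (intro card_mono) auto
      moreover have "B \<inter> {z. z \<noteq> s} = B - {s}" by auto
      then have "real (card (B \<inter> {z. z \<noteq> s})) = real (card (A w)) - 2"
        using sB finB cardB c True by simp
      \<comment> \<open>If \<open>card (A w) = 2\<close>, the second summand is
        \<open>0 / 0\<close>, which is 0, so the bound covers this case too.\<close>
      ultimately show "card (B \<inter> {z. z = x0}) + card (B \<inter> {z. z \<noteq> s}) / (real (card (A w)) - 2) \<le> 2"
        by (simp add: divide_self_if)
    qed (rule T0)
    also have "2 * T = 2 / (real (card (A w)) - 1) * (real (card B) * T)"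
      using cB c by simp
    finally show ?thesis using True by simp
  qed
  finally show ?case by (simp add: total Q_def u_def)
qed

end

section \<open>Edge schemes\<close>

lemma dart_familyD:
  assumes "dart_family n D"
  shows "disjoint_family_on D {..<n}" "i < n \<Longrightarrow> finite (D i)" "i < n \<Longrightarrow> card (D i) = n - 1"
    and "i < n \<Longrightarrow> j < n \<Longrightarrow> d \<in> D i \<Longrightarrow> d \<in> D j \<Longrightarrow> i = j"
  using assms by (auto simp: dart_family_def disjoint_family_on_def)

text \<open>Label the darts at \<open>i\<close> bijectively by the other vertices, let
  \<open>g i j\<close> be the dart at \<open>i\<close> labelled \<open>j\<close>, and let
  \<open>E\<close> exchange \<open>g i j\<close> with \<open>g j i\<close>. Existence makes the
  sample space nonempty.\<close>

lemma edge_scheme_exists: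
  assumes D: "dart_family n D"
  shows "\<exists>E. edge_scheme n D E"
proof -
  have "\<exists>f. bij_betw f (D i) ({..<n} - {i})" if "i < n" for i
    using that dart_familyD[OF D] by (intro finite_same_card_bij) auto
  then obtain f where f: "\<And>i. i < n \<Longrightarrow> bij_betw (f i) (D i) ({..<n} - {i})" by metis
  define g where "g i = inv_into (D i) (f i)" for i
  have fin: "f i d < n" "f i d \<noteq> i" if "i < n" "d \<in> D i" for i d
    using bij_betwE[OF f[OF that(1)]] that by auto
  have g: "g i j \<in> D i" "f i (g i j) = j" if "i < n" "j < n" "i \<noteq> j" for i j
    using f[OF that(1)] that
    by (auto simp: g_def bij_betw_def inv_into_into f_inv_into_f)
  have gf: "g i (f i d) = d" if "i < n" "d \<in> D i" for i d
    using f[OF that(1)] that by (auto simp: g_def bij_betw_def)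
  define b where "b d = (THE i. i < n \<and> d \<in> D i)" for d
  have b: "b d = i" if "i < n" "d \<in> D i" for d i
    using that dart_familyD(4)[OF D] unfolding b_def by blast
  define E where "E d = (if d \<in> darts n D then g (f (b d) d) (b d) else d)" for d
  have E: "E d = g (f i d) i" if "i < n" "d \<in> D i" for d i
    using that b[OF that] by (auto simp: E_def darts_def)
  have E_in: "E d \<in> D (f i d)" if "i < n" "d \<in> D i" for d i
    using g(1) fin[OF that] that E[OF that] by simp
  have f_E: "f (f i d) (E d) = i" if "i < n" "d \<in> D i" for d i
    using g(2) fin[OF that] that E[OF that] by simp
  have EE: "E (E d) = d" if "i < n" "d \<in> D i" for d i
    using E[OF fin(1)[OF that] E_in[OF that]] f_E[OF that] gf[OF that] by simp
  have E_ne: "E d \<noteq> d" if "i < n" "d \<in> D i" for d i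
    using dart_familyD(4)[OF D that(1) fin(1)[OF that] that(2)] E_in[OF that] fin(2)[OF that] by auto
  have EE': "E (E d) = d" for d
  proof (cases "d \<in> darts n D")
    case True
    then obtain i where "i < n" "d \<in> D i" by (auto simp: darts_def)
    then show ?thesis by (rule EE)
  next
    case False
    then show ?thesis by (simp add: E_def)
  qed
  have perm: "E permutes darts n D"
    unfolding permutes_def
  proof (intro conjI allI impI)
    show "E d = d" if "d \<notin> darts n D" for d using that by (simp add: E_def)
    show "\<exists>!x. E x = d" for d using EE' by metis
  qed
  have "\<exists>!C. C \<in> (\<lambda>d. {d, E d}) ` darts n D \<and> C \<inter> D i \<noteq> {} \<and> C \<inter> D j \<noteq> {}"
    if ij: "i < n" "j < n" "i \<noteq> j" for i j
  proof (rule ex1I)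
    define d where "d = g i j"
    have d: "d \<in> D i" "f i d = j" using g[OF ij] by (auto simp: d_def)
    then show "{d, E d} \<in> (\<lambda>d. {d, E d}) ` darts n D \<and> {d, E d} \<inter> D i \<noteq> {} \<and> {d, E d} \<inter> D j \<noteq> {}"
      using E_in[OF ij(1) d(1)] ij by (auto simp: darts_def)
    have unique: "e = d" if "e \<in> D i" "E e \<in> D j" for e
    proof -
      have "f i e = j"
        using dart_familyD(4)[OF D fin(1)[OF ij(1) that(1)] ij(2)] E_in[OF ij(1) that(1)] that by blast
      then show ?thesis using gf[OF ij(1) that(1)] by (simp add: d_def)
    qed
    fix C assume C: "C \<in> (\<lambda>d. {d, E d}) ` darts n D \<and> C \<inter> D i \<noteq> {} \<and> C \<inter> D j \<noteq> {}"
    then obtain e where e: "C = {e, E e}" by blast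
    have "e \<in> D i \<or> E e \<in> D i" "e \<in> D j \<or> E e \<in> D j" using C e by auto
    moreover have "\<not> (a \<in> D i \<and> a \<in> D j)" for a using dart_familyD(4)[OF D ij(1,2)] ij(3) by blast
    ultimately consider "e \<in> D i" "E e \<in> D j" | "E e \<in> D i" "e \<in> D j" by blast
    then show "C = {d, E d}"
    proof cases
      case 1
      then show ?thesis using unique e by simp
    next
      case 2
      then have "E e = d" using unique[of "E e"] EE' by simp
      then show ?thesis using e EE'[of e] by auto
    qed
  qed
  then have "edge_scheme n D E"
    unfolding edge_scheme_def using perm E_ne EE' by (auto simp: darts_def)
  then show ?thesis by (rule exI[of _ E])
qed

text \<open>Two such darts would span the same 2-cycle, and a 2-cycle that joins the disjoint sets
  \<open>D i\<close> and \<open>D j\<close> has only one dart in \<open>D i\<close>.\<close>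

lemma edge_scheme_spoke:
  assumes D: "dart_family n D" and E: "edge_scheme n D E" and ij: "i < n" "j < n" "i \<noteq> j"
  shows "\<exists>!s. s \<in> D i \<and> E s \<in> D j"
proof -
  have inv: "E (E d) = d" if "d \<in> darts n D" for d using E that by (simp add: edge_scheme_def)
  have ex1: "\<exists>!C. C \<in> (\<lambda>d. {d, E d}) ` darts n D \<and> C \<inter> D i \<noteq> {} \<and> C \<inter> D j \<noteq> {}"
    using E ij by (simp add: edge_scheme_def)
  then obtain d where d: "d \<in> darts n D" "{d, E d} \<inter> D i \<noteq> {}" "{d, E d} \<inter> D j \<noteq> {}" by blast
  have apart: "\<not> (a \<in> D i \<and> a \<in> D j)" for a
    using dart_familyD(4)[OF D ij(1,2)] ij(3) by blast
  then consider "d \<in> D i" "E d \<in> D j" | "E d \<in> D i" "d \<in> D j" using d by blast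
  then have ex: "\<exists>s. s \<in> D i \<and> E s \<in> D j"
  proof cases
    case 2
    then show ?thesis using inv[OF d(1)] by auto
  qed blast
  have edge: "{t, E t} \<in> (\<lambda>d. {d, E d}) ` darts n D \<and> {t, E t} \<inter> D i \<noteq> {} \<and> {t, E t} \<inter> D j \<noteq> {}"
    if "t \<in> D i" "E t \<in> D j" for t
    using that ij by (auto simp: darts_def)
  have "s = s'" if "s \<in> D i" "E s \<in> D j" "s' \<in> D i" "E s' \<in> D j" for s s'
  proof -
    have "{s, E s} = {s', E s'}"
      using the1_equality[OF ex1 edge[OF that(1,2)]] the1_equality[OF ex1 edge[OF that(3,4)]]
      by (rule trans[OF sym])
    then show ?thesis using that apart by (metis doubleton_eq_iff)
  qed
  with ex show ?thesis by blast
qed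

text \<open>The spokes from \<open>i\<close> to the \<open>n - 1\<close> other vertices are
  distinct, and \<open>D i\<close> has only \<open>n - 1\<close> darts, so they exhaust
  \<open>D i\<close>.\<close>

lemma edge_scheme_not_same_vertex:
  assumes D: "dart_family n D" and E: "edge_scheme n D E" and z: "i < n" "z \<in> D i"
  shows "E z \<notin> D i"
proof -
  obtain s where s: "\<And>j. j < n \<Longrightarrow> j \<noteq> i \<Longrightarrow> s j \<in> D i \<and> E (s j) \<in> D j"
    using edge_scheme_spoke[OF D E z(1)] by metis
  have "inj_on s ({..<n} - {i})"
  proof (rule inj_onI)
    fix j k assume jk: "j \<in> {..<n} - {i}" "k \<in> {..<n} - {i}" "s j = s k"
    then show "j = k" using s[of j] s[of k] dart_familyD(4)[OF D, of j k "E (s j)"] by auto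
  qed
  then have "card (s ` ({..<n} - {i})) = card (D i)"
    using dart_familyD(3)[OF D z(1)] z(1) by (simp add: card_image)
  moreover have "s ` ({..<n} - {i}) \<subseteq> D i" using s by auto
  ultimately have "s ` ({..<n} - {i}) = D i" using dart_familyD(2)[OF D z(1)] by (intro card_subset_eq)
  then obtain j where "j < n" "j \<noteq> i" "z = s j" using z by auto
  then show ?thesis using s[of j] dart_familyD(4)[OF D _ z(1), of j "E z"] by auto
qed

section \<open>The probability that a face misses a vertex\<close>

text \<open>On a face that misses \<open>v\<close>, no dart \<open>z\<close> has
  \<open>nb z = v\<close>, since the next dart \<open>R (E z)\<close> would be at \<open>v\<close>.
  The face is then a walk from \<open>x\<close> back to \<open>x\<close> that avoids these darts,
  and the walk bound applies to the full family, where
  \<open>card (D w) - 1 = n - 2\<close>.\<close>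

lemma card_face_avoids_le:
  assumes D: "dart_family n D" and E: "edge_scheme n D E" and v: "v < n"
    and x: "x \<in> darts n D - D v"
  shows "real (card {R. rotation_system n D R \<and> \<not> vertex_in_face D v (darts n D, R, E) x})
    \<le> real (card {R. rotation_system n D R}) / (real n - 2)"
proof -
  obtain w where w_n: "w < n" and x_w: "x \<in> D w" and "v \<noteq> w" using x by (auto simp: darts_def)
  have E_perm: "E permutes darts n D" and inv: "\<And>d. d \<in> darts n D \<Longrightarrow> E (E d) = d"
    using E by (auto simp: edge_scheme_def)
  define nb where "nb z = (THE j. j < n \<and> E z \<in> D j)" for z
  have nb_eq: "nb z = j" if "j < n" "E z \<in> D j" for z j
    using that dart_familyD(4)[OF D] unfolding nb_def by blast
  have nb: "nb z < n \<and> E z \<in> D (nb z)" if "z \<in> darts n D" for z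
  proof -
    have "E z \<in> darts n D" using permutes_in_image[OF E_perm] that by simp
    then obtain j where "j < n" "E z \<in> D j" by (auto simp: darts_def)
    then show ?thesis using nb_eq by auto
  qed
  have in_darts: "z \<in> darts n D" if "i < n" "z \<in> D i" for i z using that by (auto simp: darts_def)
  have finR: "finite {R. rotation_system n D R}"
    using dart_familyD[OF D] by (intro finite_rotation_systems)
  have n: "n \<ge> 2" using v w_n \<open>v \<noteq> w\<close> by linarith
  have avoids: "E z \<notin> D v"
    if "rotation_system n D R" "\<not> vertex_in_face D v (darts n D, R, E) x" "z \<in> orbit (R \<circ> E) x" for R z
  proof
    assume "E z \<in> D v"
    moreover have "cyclic_on R (D v)" using that v by (auto simp: rotation_system_def)
    ultimately have "R (E z) \<in> D v" by (rule cyclic_on_inI[rotated])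
    moreover have "(R \<circ> E) z \<in> orbit (R \<circ> E) x" using that(3) by (rule orbit.step)
    ultimately show False using that(2) by (auto simp: vertex_in_face_def face_def)
  qed
  \<comment> \<open>An \<open>orbit\<close> begins with the image of its base point; that it
    contains \<open>x\<close> itself uses that \<open>R \<circ> E\<close> is a permutation of a
    finite set.\<close>
  have self: "x \<in> orbit (R \<circ> E) x" if "rotation_system n D R" for R
  proof (rule permutation_self_in_orbit)
    have "R \<circ> E permutes darts n D"
      using that E_perm by (intro permutes_compose) (auto simp: rotation_system_def)
    moreover have "finite (darts n D)" using dart_familyD[OF D] by (auto simp: darts_def)
    ultimately show "permutation (R \<circ> E)" by (auto simp: permutation_permutes)
  qed
  have orbit_darts: "z \<in> darts n D" if "rotation_system n D R" "z \<in> orbit (R \<circ> E) x" for R z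
  proof -
    have "R \<circ> E permutes darts n D"
      using that E_perm by (intro permutes_compose) (auto simp: rotation_system_def)
    from that(2) show ?thesis
      by induction (use x permutes_in_image[OF \<open>R \<circ> E permutes darts n D\<close>] in auto)
  qed
  show ?thesis
  proof (cases "nb x = v")
    case True
    then have "E x \<in> D v" using nb x by auto
    \<comment> \<open>Every rotation takes the first step to a dart at \<open>v\<close>. For
      \<open>n = 2\<close> this is the only case, and the right-hand side is then 0 through division
      by zero.\<close>
    then have "{R. rotation_system n D R \<and> \<not> vertex_in_face D v (darts n D, R, E) x} = {}"
      using avoids self by blast
    then show ?thesis using n by (simp only: card.empty of_nat_0) simp
  next
    case False
    interpret face_walk n D nb v w x
    proof
      show "inj_on nb (D i)" if "i < n" for i
      proof (rule inj_onI)
        fix a b assume ab: "a \<in> D i" "b \<in> D i" "nb a = nb b"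
        then have "i \<noteq> nb a" using edge_scheme_not_same_vertex[OF D E that ab(1)] nb[OF in_darts[OF that ab(1)]] by auto
        then show "a = b"
          using edge_scheme_spoke[OF D E that, of "nb a"] nb[OF in_darts[OF that ab(1)]]
            nb[OF in_darts[OF that ab(2)]] ab by metis
      qed
      show "nb z \<noteq> i" if "i < n" "z \<in> D i" for i z
        using edge_scheme_not_same_vertex[OF D E that] nb[OF in_darts[OF that]] by auto
    qed (use dart_familyD[OF D] v w_n x_w \<open>v \<noteq> w\<close> False nb in_darts in auto)
    have "walk_state D E x"
      unfolding walk_state_def
    proof (intro conjI)
      show "D v \<noteq> {}" using dart_familyD(3)[OF D v] n by auto
      show "inj E" using E_perm by (rule permutes_inj)
      show "\<forall>z\<in>insert x (darts n D - {x}). E z \<in> D (nb z)" using nb x by auto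
      show "\<forall>i<n. i \<noteq> v \<longrightarrow> (\<exists>s\<in>D i. nb s = v)"
        using edge_scheme_spoke[OF D E _ v] nb_eq[OF v] by metis
      show "\<forall>z\<in>insert x (darts n D) - D v. nb (E z) \<noteq> v"
      proof
        fix z assume "z \<in> insert x (darts n D) - D v"
        then have z: "z \<in> darts n D" "z \<notin> D v" using x by auto
        then have "E z \<in> darts n D" using permutes_in_image[OF E_perm] by simp
        then show "nb (E z) \<noteq> v" using nb[of "E z"] inv[OF z(1)] z(2) by auto
      qed
    qed (use x x_w False in auto)
    note bound = card_returns_avoiding_le[OF this]
    \<comment> \<open>The walk starts with an edge leaving \<open>w\<close>, so the factor in the
      bound is 1 and not 2.\<close>
    have "nb x \<noteq> w" using nb_neq w_n x_w by blast
    have "{R. rotation_system n D R \<and> \<not> vertex_in_face D v (darts n D, R, E) x} \<subseteq>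
        {R. rotation_system n D R \<and> returns_avoiding (R \<circ> E) {z. nb z = v} x x}"
    proof safe
      fix R assume R: "rotation_system n D R" "\<not> vertex_in_face D v (darts n D, R, E) x"
      have "orbit (R \<circ> E) x \<inter> {z. nb z = v} = {}"
        using avoids[OF R] nb orbit_darts[OF R(1)] by blast
      then show "returns_avoiding (R \<circ> E) {z. nb z = v} x x"
        using self[OF R(1)] False by (intro orbit_imp_returns_avoiding) auto
    qed
    then have "card {R. rotation_system n D R \<and> \<not> vertex_in_face D v (darts n D, R, E) x} \<le>
        card {R. rotation_system n D R \<and> returns_avoiding (R \<circ> E) {z. nb z = v} x x}"
      using finR by (intro card_mono) (auto elim!: rev_finite_subset)
    also note bound
    finally show ?thesis
      using \<open>nb x \<noteq> w\<close> dart_familyD(3)[OF D w_n] n by (simp add: of_nat_diff)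
  qed
qed

text \<open>The sample space is a product of edge schemes and rotation systems, so a bound that
  holds for every fixed \<open>E\<close> survives averaging over \<open>E\<close>.\<close>

lemma prob_avoid_le:
  assumes D: "dart_family n D" and v: "v < n" and x: "x \<in> darts n D - D v"
  shows "prob_avoid n D v x \<le> 1 / (real n - 2)"
proof -
  define \<R> where "\<R> = {R. rotation_system n D R}"
  define \<E> where "\<E> = {E. edge_scheme n D E}"
  define mk where "mk = (\<lambda>(E, R). (darts n D, R :: 'a \<Rightarrow> 'a, E :: 'a \<Rightarrow> 'a))"
  define bad where "bad E = {R. rotation_system n D R \<and> \<not> vertex_in_face D v (darts n D, R, E) x}" for E
  obtain w where w: "w < n" "w \<noteq> v" using x by (auto simp: darts_def)
  have n: "n \<ge> 2" using v w by linarith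
  have ne: "D i \<noteq> {}" if "i < n" for i using dart_familyD(3)[OF D that] n by auto
  have "card \<R> = (\<Prod>i<n. fact (card (D i) - 1))"
    unfolding \<R>_def using dart_familyD[OF D] ne by (intro card_rotation_systems) auto
  then have R: "card \<R> > 0" by (simp add: prod_pos)
  then have finR: "finite \<R>" by (rule card_ge_0_finite)
  have finE: "finite \<E>"
  proof (rule finite_subset)
    show "\<E> \<subseteq> {E. E permutes darts n D}" by (auto simp: \<E>_def edge_scheme_def)
    show "finite {E. E permutes darts n D}"
      using dart_familyD[OF D] by (intro finite_permutations) (auto simp: darts_def)
  qed
  have "\<E> \<noteq> {}" using edge_scheme_exists[OF D] by (auto simp: \<E>_def)
  then have E: "card \<E> > 0" using finE by (simp add: card_gt_0_iff)
  have maps: "maps_K n D = mk ` (\<E> \<times> \<R>)"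
    by (auto simp: maps_K_def mk_def \<E>_def \<R>_def)
  have inj: "inj_on mk S" for S by (auto simp: mk_def inj_on_def)
  have card_maps: "card (maps_K n D) = card \<E> * card \<R>"
    by (simp add: maps card_image[OF inj] card_cartesian_product)
  have bad_fin: "finite (bad E)" for E
    using finR by (rule rev_finite_subset) (auto simp: bad_def \<R>_def)
  have "maps_K n D \<inter> {m. \<not> vertex_in_face D v m x} = mk ` (Sigma \<E> bad)"
    unfolding maps by (auto simp: mk_def \<R>_def bad_def)
  then have "real (card (maps_K n D \<inter> {m. \<not> vertex_in_face D v m x})) = (\<Sum>E\<in>\<E>. real (card (bad E)))"
    using finE bad_fin by (simp add: card_image[OF inj])
  also have "\<dots> \<le> (\<Sum>E\<in>\<E>. real (card \<R>) / (real n - 2))"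
    unfolding bad_def \<R>_def
    by (intro sum_mono card_face_avoids_le[OF D _ v x]) (simp add: \<E>_def)
  also have "\<dots> = real (card (maps_K n D)) * (1 / (real n - 2))" by (simp add: card_maps)
  finally have "real (card (maps_K n D \<inter> {m. \<not> vertex_in_face D v m x})) / real (card (maps_K n D))
      \<le> 1 / (real n - 2)"
    using E R by (simp add: card_maps divide_le_eq mult.commute)
  moreover have "finite (maps_K n D)" "maps_K n D \<noteq> {}"
    using finE finR E R by (auto simp: maps)
  ultimately show ?thesis by (simp add: prob_avoid_def measure_pmf_of_set)
qed

text \<open>Dart sets change with \<open>n\<close>, so the limit is taken along arbitrary choices
  that are eventually admissible.\<close>

theorem theorem5:
  "(\<forall>\<^sub>F n in sequentially. \<forall>(D :: nat \<Rightarrow> 'a set) v x.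
      dart_family n D \<and> v < n \<and> x \<in> darts n D - D v \<longrightarrow>
      prob_avoid n D v x \<le> 4 * ln (real n - 1) / (exp 1 * (real n - 1)))
   \<and>
   (\<forall>(D :: nat \<Rightarrow> nat \<Rightarrow> 'a set) v x.
      (\<forall>\<^sub>F n in sequentially.
         dart_family n (D n) \<and> v n < n \<and> x n \<in> darts n (D n) - D n (v n)) \<longrightarrow>
      (\<lambda>n. prob_avoid n (D n) (v n) (x n)) \<longlonglongrightarrow> 0)"
proof (intro conjI allI impI)
  \<comment> \<open>The quotient of the two sides grows like \<open>(4 / e) ln n\<close>, so the
    logarithm eventually absorbs all constants.\<close>
  have "\<forall>\<^sub>F n in sequentially. 1 / (real n - 2) \<le> 4 * ln (real n - 1) / (exp 1 * (real n - 1))"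
    by real_asymp
  then show "\<forall>\<^sub>F n in sequentially. \<forall>(D :: nat \<Rightarrow> 'a set) v x.
      dart_family n D \<and> v < n \<and> x \<in> darts n D - D v \<longrightarrow>
      prob_avoid n D v x \<le> 4 * ln (real n - 1) / (exp 1 * (real n - 1))"
    by eventually_elim (auto intro: order_trans[OF prob_avoid_le])
next
  fix D :: "nat \<Rightarrow> nat \<Rightarrow> 'a set" and v x
  assume *: "\<forall>\<^sub>F n in sequentially.
      dart_family n (D n) \<and> v n < n \<and> x n \<in> darts n (D n) - D n (v n)"
  show "(\<lambda>n. prob_avoid n (D n) (v n) (x n)) \<longlonglongrightarrow> 0"
  proof (rule tendsto_sandwich[of "\<lambda>_. 0"])
    show "(\<lambda>n. 1 / (real n - 2)) \<longlonglongrightarrow> 0" by real_asymp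
    show "\<forall>\<^sub>F n in sequentially. prob_avoid n (D n) (v n) (x n) \<le> 1 / (real n - 2)"
      using * by eventually_elim (auto intro: prob_avoid_le)
  qed (auto simp: prob_avoid_def)
qed

end
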